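(* Let $n$ be a positive integer and let $s,t$ be primes satisfying $n<s<t$ and $s\equiv -t\pmod n$. Then $V_{ns}=-V_{nt}$.
   Context: $\Phi_m(x)$ denotes the $m$th cyclotomic polynomial. For a polynomial $f\in\mathbb Z[x]$, $V(f)=\{[x^k]f(x):k\in\mathbb Z\}$ is its set of coefficients including $0$, and $V_m:=V(\Phi_m(x))$. For a set $S$ of integers, $-S=\{-a:a\in S\}$.
   Formalization: The positive integer n is assumed to be greater than 1: for n = 1 the claim is false for all primes s < t, since then V_s = V_t = {0,1} while -V_t = {0,-1} (for example s = 2, t = 3). *)

theory Defs
  imports Complex_Main "HOL-Computational_Algebra.Computational_Algebra" "HOL-Number_Theory.Cong"
begin

definition primitive_roots_unity :: "nat \<Rightarrow> complex set" where
  "primitive_roots_unity m = {z. z ^ m = 1 \<and> (\<forall>k\<in>{0<..<m}. z ^ k \<noteq> 1)}"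

definition is_cyclotomic :: "nat \<Rightarrow> int poly \<Rightarrow> bool" where
  "is_cyclotomic m p \<longleftrightarrow>
     map_poly of_int p = (\<Prod>z\<in>primitive_roots_unity m. [:- z, 1:])"

text \<open>Only meaningful for positive \<open>m\<close>; the lemma \<open>is_cyclotomic_cyclotomic\<close> below shows
  that the polynomial described here then exists (and is unique).\<close>

definition cyclotomic :: "nat \<Rightarrow> int poly" where
  "cyclotomic m = (THE p. is_cyclotomic m p)"

text \<open>Since \<open>coeff f k = 0\<close> for \<open>k > degree f\<close>, the range contains 0, just as when
  \<open>k\<close> ranges over all integers.\<close>

definition coeff_set :: "int poly \<Rightarrow> int set" where
  "coeff_set f = range (coeff f)"

text \<open>Pitfall at \<open>m\<close> prime: all nonzero coefficients of the cyclotomic polynomial are then 1,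
  so the set is \<open>{0, 1}\<close>. Hence \<open>V\<^sub>n\<^sub>s = - V\<^sub>n\<^sub>t\<close> fails for \<open>n = 1\<close>, where the congruence
  \<open>s \<equiv> - t\<close> modulo \<open>n\<close> is vacuous, and \<open>n > 1\<close> has to be assumed.\<close>

definition cyclotomic_coeffs :: "nat \<Rightarrow> int set" where
  "cyclotomic_coeffs m = coeff_set (cyclotomic m)"

lemma is_cyclotomic_unique:
  assumes "is_cyclotomic m p" "is_cyclotomic m q"
  shows "p = q"
proof (rule poly_eqI)
  fix n
  have "map_poly (of_int :: int \<Rightarrow> complex) p = map_poly of_int q"
    using assms by (simp add: is_cyclotomic_def)
  then have "coeff (map_poly (of_int :: int \<Rightarrow> complex) p) n = coeff (map_poly of_int q) n"
    by simp
  then show "coeff p n = coeff q n"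
    by (simp add: coeff_map_poly)
qed

lemma unity_minimal_exponent:
  fixes z :: complex
  assumes "z ^ m = 1" "m > 0"
  shows "\<exists>d. d dvd m \<and> d > 0 \<and> z \<in> primitive_roots_unity d"
proof -
  define d where "d = (LEAST k. k > 0 \<and> z ^ k = 1)"
  have d: "d > 0 \<and> z ^ d = 1"
    unfolding d_def
    by (rule LeastI[of "\<lambda>k. k > 0 \<and> z ^ k = 1" m]) (use assms in simp)
  have least: "d \<le> k" if "k > 0" "z ^ k = 1" for k
    unfolding d_def by (rule Least_le) (use that in simp)
  have "z ^ m = z ^ (d * (m div d) + m mod d)"
    by simp
  also have "\<dots> = z ^ (m mod d)"
    using d by (simp only: power_add power_mult) simp
  finally have "z ^ (m mod d) = 1"
    using assms by simp
  then have "m mod d = 0"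
    using least[of "m mod d"] d by (meson gr0I leD mod_less_divisor)
  moreover have "z \<in> primitive_roots_unity d"
    unfolding primitive_roots_unity_def
  proof (intro CollectI conjI ballI)
    show "z ^ d = 1"
      using d ..
  next
    fix k
    assume "k \<in> {0<..<d}"
    then show "z ^ k \<noteq> 1"
      using least[of k] by (metis greaterThanLessThan_iff leD)
  qed
  ultimately show ?thesis
    using d by (metis dvd_eq_mod_eq_0)
qed

lemma primitive_roots_unity_disjoint:
  assumes "d > 0" "e > 0" "d \<noteq> e"
  shows "primitive_roots_unity d \<inter> primitive_roots_unity e = {}"
  using assms by (cases d e rule: linorder_cases) (auto simp: primitive_roots_unity_def)

lemma roots_unity_eq:
  assumes "m > 0"
  shows "{z::complex. z ^ m = 1} = (\<Union>d\<in>{d. d dvd m}. primitive_roots_unity d)"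
proof (intro subset_antisym subsetI)
  fix z :: complex
  assume "z \<in> {z. z ^ m = 1}"
  then show "z \<in> (\<Union>d\<in>{d. d dvd m}. primitive_roots_unity d)"
    using unity_minimal_exponent[OF _ assms] by blast
next
  fix z
  assume "z \<in> (\<Union>d\<in>{d. d dvd m}. primitive_roots_unity d)"
  then show "z \<in> {z. z ^ m = 1}"
    by (auto simp: primitive_roots_unity_def power_mult elim!: dvdE)
qed

lemma finite_primitive_roots_unity:
  assumes "m > 0"
  shows "finite (primitive_roots_unity m)"
  by (rule finite_subset[OF _ finite_roots_unity[of m]])
     (use assms in \<open>auto simp: primitive_roots_unity_def\<close>)

lemma prod_linear_monic:
  fixes A :: "complex set"
  assumes "finite A"
  shows "lead_coeff (\<Prod>z\<in>A. [:- z, 1:]) = 1" "degree (\<Prod>z\<in>A. [:- z, 1:]) = card A"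
proof -
  show "lead_coeff (\<Prod>z\<in>A. [:- z, 1:]) = 1"
    by (simp add: lead_coeff_prod)
  show "degree (\<Prod>z\<in>A. [:- z, 1:]) = card A"
    by (subst degree_prod_eq_sum_degree) auto
qed

lemma prod_roots_unity:
  assumes "m > 0"
  shows "(\<Prod>z\<in>{z::complex. z ^ m = 1}. [:- z, 1:]) = monom 1 m - 1" (is "?P = ?Q")
proof -
  let ?A = "{z::complex. z ^ m = 1}"
  have fin: "finite ?A"
    using assms by (intro finite_roots_unity) simp
  have card: "card ?A = m"
    using assms by (simp add: card_roots_unity_eq)
  have degP: "degree ?P = m" and lcP: "coeff ?P m = 1"
    using prod_linear_monic[OF fin] card by auto
  have "?P - ?Q = 0"
  proof (rule ccontr)
    assume nz: "?P - ?Q \<noteq> 0"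
    have "degree (?P - ?Q) \<le> m"
      using degP by (intro degree_diff_le) (auto simp: degree_monom_le)
    moreover have "coeff (?P - ?Q) m = 0"
      using lcP assms by simp
    ultimately have less: "degree (?P - ?Q) < m"
      using nz by (metis le_neq_implies_less leading_coeff_0_iff)
    have "?A \<subseteq> {z. poly (?P - ?Q) z = 0}"
      using fin by (auto simp: poly_prod poly_monom)
    then have "m \<le> card {z. poly (?P - ?Q) z = 0}"
      using card card_mono[OF poly_roots_finite[OF nz]] by metis
    also have "\<dots> \<le> degree (?P - ?Q)"
      by (rule card_poly_roots_bound[OF nz])
    finally show False
      using less by simp
  qed
  then show ?thesis by simp
qed

lemma map_poly_of_int_mult:
  "map_poly (of_int :: int \<Rightarrow> complex) (p * q) = map_poly of_int p * map_poly of_int q"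
  by (rule poly_eqI) (simp add: coeff_map_poly coeff_mult)

lemma map_poly_of_int_add:
  "map_poly (of_int :: int \<Rightarrow> complex) (p + q) = map_poly of_int p + map_poly of_int q"
  by (rule poly_eqI) (simp add: coeff_map_poly)

lemma map_poly_of_int_prod:
  "map_poly (of_int :: int \<Rightarrow> complex) (prod f A) = (\<Prod>x\<in>A. map_poly of_int (f x))"
  by (induction A rule: infinite_finite_induct)
     (auto simp: map_poly_of_int_mult map_poly_1)

lemma degree_map_poly_of_int:
  "degree (map_poly (of_int :: int \<Rightarrow> complex) p) = degree p"
  by (rule degree_map_poly) simp

lemma is_cyclotomic_exists:
  assumes "m > 0"
  shows "\<exists>p. is_cyclotomic m p"
  using assms
proof (induction m rule: less_induct)
  case (less m)
  let ?h = "map_poly (of_int :: int \<Rightarrow> complex)"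
  let ?F = "\<lambda>d. \<Prod>z\<in>primitive_roots_unity d. [:- z, 1:]"
  let ?D = "{d. d dvd m} - {m}"
  have pos: "d > 0" if "d dvd m" for d
    using that less.prems by (auto intro: Nat.gr0I)
  have finD: "finite {d. d dvd m}"
    using less.prems by simp
  have "\<forall>d\<in>?D. \<exists>p. is_cyclotomic d p"
  proof
    fix d
    assume d: "d \<in> ?D"
    then have "d < m" "d > 0"
      using less.prems pos dvd_imp_le[of d m] by auto
    then show "\<exists>p. is_cyclotomic d p"
      by (rule less.IH)
  qed
  then obtain c where c: "\<And>d. d \<in> ?D \<Longrightarrow> is_cyclotomic d (c d)"
    by metis
  define q where "q = (\<Prod>d\<in>?D. c d)"
  have hq: "?h q = (\<Prod>d\<in>?D. ?F d)"
    unfolding q_def map_poly_of_int_prod using c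
    by (intro prod.cong) (auto simp: is_cyclotomic_def)
  have "monom 1 m - 1 = (\<Prod>z\<in>(\<Union>d\<in>{d. d dvd m}. primitive_roots_unity d). [:- z, 1:])"
    using prod_roots_unity[OF less.prems] roots_unity_eq[OF less.prems] by simp
  also have "\<dots> = (\<Prod>d\<in>{d. d dvd m}. ?F d)"
    using finD pos finite_primitive_roots_unity primitive_roots_unity_disjoint
    by (intro prod.UNION_disjoint) auto
  also have "\<dots> = ?F m * ?h q"
    unfolding hq using finD by (subst prod.remove[of _ m]) auto
  finally have eq: "monom 1 m - 1 = ?F m * ?h q" .
  have "lead_coeff (?h q) = 1"
    unfolding hq lead_coeff_prod
    using pos finite_primitive_roots_unity prod_linear_monic(1) by (intro prod.neutral) auto
  then have lcq: "lead_coeff q = 1"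
    by (simp add: degree_map_poly_of_int coeff_map_poly)
  then have q0: "q \<noteq> 0" by auto
  define f :: "int poly" where "f = monom 1 m - 1"
  obtain a r where ar: "pseudo_divmod f q = (a, r)"
    by fastforce
  have f: "f = q * a + r" and r: "r = 0 \<or> degree r < degree q"
    using pseudo_divmod[OF q0 ar] lcq by auto
  have hf: "?h f = monom 1 m - 1"
    unfolding f_def by (rule poly_eqI) (auto simp: coeff_map_poly)
  have "?h q * ?h a + ?h r = ?F m * ?h q"
    using hf eq f by (metis map_poly_of_int_add map_poly_of_int_mult)
  then have r_eq: "?h r = ?h q * (?F m - ?h a)"
    by (simp add: algebra_simps)
  have hq0: "?h q \<noteq> 0"
    using \<open>lead_coeff (?h q) = 1\<close> by auto
  have "?F m - ?h a = 0"
  proof (rule ccontr)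
    assume nz: "?F m - ?h a \<noteq> 0"
    then have "degree (?h q) \<le> degree (?h r)" "?h r \<noteq> 0"
      unfolding r_eq using hq0 by (simp_all add: degree_mult_eq)
    then show False
      using r by (auto simp: degree_map_poly_of_int)
  qed
  then show ?case
    by (auto simp: is_cyclotomic_def intro!: exI[of _ a])
qed

lemma is_cyclotomic_cyclotomic:
  assumes "m > 0"
  shows "is_cyclotomic m (cyclotomic m)"
  unfolding cyclotomic_def
  using is_cyclotomic_exists[OF assms] is_cyclotomic_unique by (blast intro: theI)

end

theory Submission
  imports Defs
begin

text \<open>
  For a prime \<open>s\<close> not dividing \<open>n\<close> we have
  \<open>\<Phi>\<^sub>n\<^sub>s(x) = \<Phi>\<^sub>n(x\<^sup>s) / \<Phi>\<^sub>n(x)\<close>. Write \<open>x\<^sup>n - 1 = \<Phi>\<^sub>n q\<close> with \<open>degree q < n\<close>.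
  Then \<open>1/\<Phi>\<^sub>n = - q / (1 - x\<^sup>n)\<close> has \<open>n\<close>-periodic coefficients \<open>b\<close>, which are antisymmetric about
  half the degree of \<open>q\<close>, since \<open>\<Phi>\<^sub>n\<close> is palindromic for \<open>n > 1\<close>.
  If \<open>a\<close> denotes the coefficients of \<open>\<Phi>\<^sub>n\<close>, the \<open>k\<close>-th coefficient of \<open>\<Phi>\<^sub>n\<^sub>s\<close> is the sum of
  \<open>a i * b (k - i * s)\<close> over \<open>i \<le> k div s\<close>, which depends only on \<open>k div s\<close>, on \<open>k\<close> modulo \<open>n\<close>
  and on \<open>s\<close> modulo \<open>n\<close>. As \<open>n < s\<close>, every quotient occurs with every residue, and replacing \<open>s\<close>
  by a prime congruent to \<open>- s\<close> reflects the argument of \<open>b\<close>, which only changes the sign.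
\<close>

section \<open>Orders of roots of unity and of their powers\<close>

lemma primitive_roots_unity_iff:
  assumes "m > 0"
  shows "z \<in> primitive_roots_unity m \<longleftrightarrow> (\<forall>k. z ^ k = 1 \<longleftrightarrow> m dvd k)"
proof
  assume z: "z \<in> primitive_roots_unity m"
  show "\<forall>k. z ^ k = 1 \<longleftrightarrow> m dvd k"
  proof
    fix k
    have zm: "z ^ m = 1"
      using z by (simp add: primitive_roots_unity_def)
    have "z ^ k = z ^ (m * (k div m) + k mod m)"
      by simp
    also have "\<dots> = z ^ (k mod m)"
      using zm by (simp only: power_add power_mult) simp
    finally have "z ^ k = z ^ (k mod m)" .
    moreover have "z ^ (k mod m) = 1 \<longleftrightarrow> k mod m = 0"
    proof
      assume "z ^ (k mod m) = 1"
      moreover have "k mod m < m"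
        using assms by simp
      ultimately show "k mod m = 0"
        using z by (auto simp: primitive_roots_unity_def)
    qed simp
    ultimately show "z ^ k = 1 \<longleftrightarrow> m dvd k"
      by (simp add: dvd_eq_mod_eq_0)
  qed
next
  assume "\<forall>k. z ^ k = 1 \<longleftrightarrow> m dvd k"
  then show "z \<in> primitive_roots_unity m"
    by (auto simp: primitive_roots_unity_def dest: nat_dvd_not_less)
qed

text \<open>If \<open>w\<close> has order \<open>d\<close> and \<open>w ^ s\<close> has order
  \<open>n\<close>, then \<open>d dvd s * k\<close> and \<open>n dvd k\<close> are equivalent.
  Cancelling \<open>s\<close>, from \<open>d\<close> if \<open>s\<close> divides it and from
  \<open>s * k\<close> by coprimality otherwise, leaves two numbers with the same multiples, so
  \<open>d\<close> is \<open>s * n\<close> or \<open>n\<close>.\<close>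

lemma power_prime_in_primitive_roots_unity_iff:
  assumes "n > 0" "prime s" "\<not> s dvd n"
  shows "w ^ s \<in> primitive_roots_unity n \<longleftrightarrow>
    w \<in> primitive_roots_unity n \<union> primitive_roots_unity (n * s)"
proof
  have s: "s > 0"
    using assms(2) by (rule prime_gt_0_nat)
  {
    assume ws: "w ^ s \<in> primitive_roots_unity n"
    then have "w ^ (s * n) = 1"
      by (simp add: primitive_roots_unity_def power_mult)
    then obtain d where d: "d > 0" "w \<in> primitive_roots_unity d"
      using unity_minimal_exponent[of w "s * n"] assms(1) s by auto
    have iff: "d dvd s * k \<longleftrightarrow> n dvd k" for k
    proof -
      have "d dvd s * k \<longleftrightarrow> w ^ (s * k) = 1"
        using d by (simp add: primitive_roots_unity_iff)
      also have "\<dots> \<longleftrightarrow> n dvd k"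
        using ws assms(1) by (simp add: primitive_roots_unity_iff power_mult)
      finally show ?thesis .
    qed
    show "w \<in> primitive_roots_unity n \<union> primitive_roots_unity (n * s)"
    proof (cases "s dvd d")
      case True
      then obtain e where e: "d = s * e" ..
      then have "e dvd k \<longleftrightarrow> n dvd k" for k
        using iff[of k] s by simp
      then have "e = n"
        by (meson dvd_antisym dvd_refl)
      then show ?thesis
        using d e by (simp add: mult.commute)
    next
      case False
      then have "coprime d s"
        using assms(2) by (simp add: prime_imp_coprime coprime_commute[of d])
      then have "d dvd k \<longleftrightarrow> n dvd k" for k
        using iff[of k] by (simp add: coprime_dvd_mult_right_iff)
      then have "d = n"
        by (meson dvd_antisym dvd_refl)
      then show ?thesis
        using d by simp
    qed
  }
  assume "w \<in> primitive_roots_unity n \<union> primitive_roots_unity (n * s)"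
  then show "w ^ s \<in> primitive_roots_unity n"
  proof
    have "coprime n s"
      using assms by (simp add: prime_imp_coprime coprime_commute[of n])
    moreover assume "w \<in> primitive_roots_unity n"
    ultimately show ?thesis
      using assms(1) by (simp add: primitive_roots_unity_iff coprime_dvd_mult_right_iff
          flip: power_mult)
  next
    assume "w \<in> primitive_roots_unity (n * s)"
    then show ?thesis
      using assms(1) s by (simp add: primitive_roots_unity_iff mult.commute[of n] flip: power_mult)
  qed
qed

section \<open>Products of linear factors\<close>

text \<open>The derivative vanishes at most at 0, which is not a root as \<open>c\<close> is
  nonzero; hence all roots are simple.\<close>

lemma prod_nth_roots:
  fixes c :: complex
  assumes "n > 0" "c \<noteq> 0"
  shows "(\<Prod>w | w ^ n = c. [:- w, 1:]) = monom 1 n - [:c:]"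
proof -
  let ?p = "monom 1 n - [:c:]"
  have deg: "degree ?p = n"
    using assms(1) by (subst diff_conv_add_uminus, subst degree_add_eq_left)
      (auto simp: degree_monom_eq)
  have "rsquarefree ?p"
    using assms by (auto simp: rsquarefree_roots poly_monom pderiv_diff pderiv_monom pderiv_pCons)
  then have "smult (lead_coeff ?p) (\<Prod>z | poly ?p z = 0. [:- z, 1:]) = ?p"
    by (rule complex_poly_decompose_rsquarefree)
  moreover have "lead_coeff ?p = 1"
    unfolding deg using assms(1) by (simp add: coeff_pCons split: nat.split)
  ultimately show ?thesis
    by (simp add: poly_monom)
qed

text \<open>Reflecting \<open>x - z\<close> gives \<open>1 - z x = -z (x - 1/z)\<close>, and
  inversion permutes \<open>A\<close>, so only a constant factor remains to be determined.\<close>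

lemma reflect_poly_prod_linear:
  fixes A :: "'a::field set"
  assumes "finite A" "inverse ` A = A" "0 \<notin> A" "1 \<notin> A"
  shows "reflect_poly (\<Prod>z\<in>A. [:- z, 1:]) = (\<Prod>z\<in>A. [:- z, 1:])" (is "reflect_poly ?p = ?p")
proof -
  have "reflect_poly ?p = (\<Prod>z\<in>A. smult (- z) [:- inverse z, 1:])"
    unfolding reflect_poly_prod
    using assms(3) by (intro prod.cong) (auto simp: reflect_poly_pCons' monom_Suc monom_0 field_simps)
  also have "\<dots> = smult (\<Prod>z\<in>A. - z) (\<Prod>z\<in>A. [:- inverse z, 1:])"
    by (rule prod_smult)
  also have "(\<Prod>z\<in>A. [:- inverse z, 1:]) = ?p"
    using prod.reindex[of inverse A "\<lambda>z. [:- z, 1:]"] assms(2) by (simp add: inj_on_def)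
  finally have eq: "reflect_poly ?p = smult (\<Prod>z\<in>A. - z) ?p" .
  \<comment> \<open>The constant factor is 1 because both sides have the same nonzero value at 1.\<close>
  have "poly ?p 1 = poly (reflect_poly ?p) 1"
    by (simp add: poly_reflect_poly_nz)
  also have "\<dots> = (\<Prod>z\<in>A. - z) * poly ?p 1"
    unfolding eq by simp
  finally have "(\<Prod>z\<in>A. - z) = 1"
    using assms by (auto simp: poly_prod)
  then show ?thesis
    using eq by simp
qed

section \<open>Cyclotomic polynomials over the complex numbers\<close>

abbreviation complex_cyclotomic :: "nat \<Rightarrow> complex poly" where
  "complex_cyclotomic m \<equiv> (\<Prod>z\<in>primitive_roots_unity m. [:- z, 1:])"

text \<open>Inversion preserves the order of a root of unity. For \<open>n = 1\<close> the root 1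
  appears, and reflection negates \<open>x - 1\<close>.\<close>

lemma reflect_complex_cyclotomic:
  assumes "n > 1"
  shows "reflect_poly (complex_cyclotomic n) = complex_cyclotomic n"
proof (rule reflect_poly_prod_linear)
  show "finite (primitive_roots_unity n)"
    using assms by (intro finite_primitive_roots_unity) simp
  have "inverse z \<in> primitive_roots_unity n" if "z \<in> primitive_roots_unity n" for z
    using that by (simp add: primitive_roots_unity_def power_inverse)
  then show "inverse ` primitive_roots_unity n = primitive_roots_unity n"
    by (force simp: image_iff intro: bexI[of _ "inverse _"])
  show "0 \<notin> primitive_roots_unity n" "1 \<notin> primitive_roots_unity n"
    using assms by (auto simp: primitive_roots_unity_def power_0_left intro!: bexI[of _ 1])
qed

text \<open>Each factor \<open>x^s - z\<close> splits over the \<open>s\<close>-th roots of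
  \<open>z\<close>. These root sets are disjoint, and their union consists of the elements of order
  \<open>n\<close> or \<open>n * s\<close>.\<close>

lemma complex_cyclotomic_pcompose_monom:
  assumes "n > 0" "prime s" "\<not> s dvd n"
  shows "pcompose (complex_cyclotomic n) (monom 1 s) =
    complex_cyclotomic n * complex_cyclotomic (n * s)"
proof -
  have s: "s > 0"
    using assms(2) by (rule prime_gt_0_nat)
  have nz: "z \<noteq> 0" if "z \<in> primitive_roots_unity n" for z
    using that assms(1) by (auto simp: primitive_roots_unity_def power_0_left)
  have "pcompose (complex_cyclotomic n) (monom 1 s) =
      (\<Prod>z\<in>primitive_roots_unity n. monom 1 s - [:z:])"
    unfolding pcompose_prod by (intro prod.cong) (auto simp: pcompose_pCons)
  also have "\<dots> = (\<Prod>z\<in>primitive_roots_unity n. \<Prod>w | w ^ s = z. [:- w, 1:])"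
    using nz s by (intro prod.cong) (simp_all add: prod_nth_roots)
  also have "\<dots> = (\<Prod>w\<in>(\<Union>z\<in>primitive_roots_unity n. {w. w ^ s = z}). [:- w, 1:])"
    using finite_primitive_roots_unity[OF assms(1)] nz s
    by (intro prod.UNION_disjoint[symmetric]) (auto intro: finite_nth_roots)
  also have "(\<Union>z\<in>primitive_roots_unity n. {w. w ^ s = z}) =
      primitive_roots_unity n \<union> primitive_roots_unity (n * s)"
    using power_prime_in_primitive_roots_unity_iff[OF assms] by auto
  also have "(\<Prod>w\<in>\<dots>. [:- w, 1:]) = complex_cyclotomic n * complex_cyclotomic (n * s)"
    using assms s prime_gt_1_nat[OF assms(2)]
    by (intro prod.union_disjoint primitive_roots_unity_disjoint finite_primitive_roots_unity) auto
  finally show ?thesis .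
qed

text \<open>Reflection negates \<open>x^n - 1\<close> and fixes its factor
  \<open>complex_cyclotomic n\<close>, so it negates the cofactor, the product over the
  non-primitive roots.\<close>

lemma complex_cyclotomic_cofactor:
  assumes "n > 1"
  obtains q where "complex_cyclotomic n * q = monom 1 n - 1" "degree q < n"
    "reflect_poly q = - q"
proof -
  let ?F = "complex_cyclotomic n"
  let ?R = "{z::complex. z ^ n = 1}"
  have fin: "finite ?R"
    using assms by (intro finite_roots_unity) simp
  have sub: "primitive_roots_unity n \<subseteq> ?R"
    by (auto simp: primitive_roots_unity_def)
  define q :: "complex poly" where "q = (\<Prod>z\<in>?R - primitive_roots_unity n. [:- z, 1:])"
  have q: "?F * q = monom 1 n - 1"
    using prod_roots_unity[of n] prod.subset_diff[OF sub fin, of "\<lambda>z. [:- z, 1:]"] assms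
    by (simp add: q_def mult.commute)
  have F0: "?F \<noteq> 0"
    using finite_subset[OF sub fin] by (simp add: prod_zero_iff)
  have "reflect_poly (monom 1 n - 1 :: complex poly) = 1 - monom 1 n"
  proof -
    have deg: "degree (monom 1 n - 1 :: complex poly) = n"
      using assms by (subst diff_conv_add_uminus, subst degree_add_eq_left)
        (auto simp: degree_monom_eq)
    show ?thesis
      using assms by (intro poly_eqI) (auto simp: coeff_reflect_poly deg coeff_pCons split: nat.split)
  qed
  then have "?F * reflect_poly q = ?F * (- q)"
    using q reflect_poly_mult[of ?F q] reflect_complex_cyclotomic[OF assms] by simp
  then have refl: "reflect_poly q = - q"
    using F0 by (metis mult_left_cancel)
  \<comment> \<open>One explicit primitive root makes the bound on the degree of \<open>q\<close>
    strict.\<close>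
  have "cis (2 * pi / n) \<in> primitive_roots_unity n"
    unfolding primitive_roots_unity_def
  proof (intro CollectI conjI ballI)
    have inj: "inj_on (\<lambda>k. cis (2 * pi * real k / real n)) {..<n}"
      using bij_betw_roots_unity[of n] assms by (simp add: bij_betw_def)
    show "cis (2 * pi / n) ^ n = 1"
      using assms by (simp add: Complex.DeMoivre)
    fix k
    assume "k \<in> {0<..<n}"
    then show "cis (2 * pi / n) ^ k \<noteq> 1"
      using inj_onD[OF inj, of k 0] by (auto simp: Complex.DeMoivre mult.commute)
  qed
  then have "?R - primitive_roots_unity n \<subset> ?R"
    using sub by blast
  then have "degree q < card ?R"
    using fin prod_linear_monic(2)[of "?R - primitive_roots_unity n"]
    by (simp add: q_def psubset_card_mono)
  then have "degree q < n"
    using assms by (simp add: card_roots_unity_eq)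
  with q refl show ?thesis
    by (intro that)
qed

section \<open>The coefficient formula for a prime multiple of the index\<close>

text \<open>\<open>b\<close> and \<open>D\<close> are fixed before \<open>s\<close>, so one periodic
  sequence serves all primes and two of them can be compared.\<close>

lemma coeff_complex_cyclotomic_prime_mult:
  assumes "n > 1"
  obtains b :: "int \<Rightarrow> complex" and D :: int where
    "\<And>j. b (D - j) = - b j"
    "\<And>i j. [i = j] (mod int n) \<Longrightarrow> b i = b j"
    "\<And>s k. prime s \<Longrightarrow> \<not> s dvd n \<Longrightarrow> coeff (complex_cyclotomic (n * s)) k =
      (\<Sum>i\<le>k div s. coeff (complex_cyclotomic n) i * b (int k - int i * int s))"
proof -
  let ?F = "complex_cyclotomic n"
  obtain q where q: "?F * q = monom 1 n - 1" "degree q < n" "reflect_poly q = - q"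
    using complex_cyclotomic_cofactor[OF assms] .
  \<comment> \<open>Reducing the index modulo \<open>n\<close> extends the coefficients of
    \<open>1 / ?F\<close> to negative indices, where \<open>D - j\<close> may land.\<close>
  define b :: "int \<Rightarrow> complex" where "b j = - coeff q (nat (j mod int n))" for j
  define D where "D = int (degree q)"
  define B where "B = Abs_fps (\<lambda>m. b (int m))"
  have cong: "b i = b j" if "[i = j] (mod int n)" for i j
    using that by (simp add: b_def cong_def)
  have refl: "coeff q (degree q - m) = - coeff q m" if "m \<le> degree q" for m
    using arg_cong[OF q(3), of "\<lambda>p. coeff p m"] that by (simp add: coeff_reflect_poly)
  have anti: "b (D - j) = - b j" for j
  proof -
    define m where "m = nat (j mod int n)"
    have m: "int m = j mod int n" "m < n"
      using assms by (auto simp: m_def nat_less_iff)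
    have "b (D - j) = b (D - int m)"
      by (intro cong) (simp add: m(1) cong_def mod_diff_right_eq)
    also have "\<dots> = coeff q m"
    proof (cases "m \<le> degree q")
      case True
      then have "(D - int m) mod int n = int (degree q - m)"
        using q(2) by (simp add: D_def of_nat_diff)
      then show ?thesis
        using refl[OF True] by (simp add: b_def)
    next
      \<comment> \<open>Here \<open>degree q < m < n\<close>, so the residue of \<open>D - m\<close>
        is \<open>D - m + n\<close>, again above the degree: both values are 0.\<close>
      case False
      then have "(D - int m) mod int n = D - int m + int n"
        using m(2) by (subst mod_add_self2[symmetric], subst mod_pos_pos_trivial)
          (auto simp: D_def)
      then have "b (D - int m) = 0"
        using False m(2) by (auto simp: b_def D_def intro!: coeff_eq_0)
      then show ?thesis
        using False by (simp add: coeff_eq_0)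
    qed
    also have "\<dots> = - b j"
      by (simp add: b_def m_def)
    finally show ?thesis .
  qed
  \<comment> \<open>By periodicity all terms from index \<open>n\<close> on cancel, leaving only the
    first block.\<close>
  have BX: "B * (1 - fps_X ^ n) = - fps_of_poly q"
  proof (rule fps_ext)
    fix m
    have "b (int m) = - coeff q m" if "m < n"
      using that by (simp add: b_def)
    moreover have "b (int m) = b (int (m - n))" "coeff q m = 0" if "n \<le> m"
      using that q(2) by (auto simp: cong_def of_nat_diff coeff_eq_0 intro!: cong)
    ultimately show "(B * (1 - fps_X ^ n)) $ m = (- fps_of_poly q) $ m"
      by (cases "m < n") (auto simp: B_def right_diff_distrib fps_X_power_mult_right_nth)
  qed
  have "fps_of_poly ?F * B * (1 - fps_X ^ n) = - fps_of_poly (?F * q)"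
    by (simp add: BX mult.assoc fps_of_poly_mult)
  also have "\<dots> = 1 * (1 - fps_X ^ n)"
    by (simp add: q(1) fps_of_poly_diff fps_of_poly_monom)
  finally have "fps_of_poly ?F * B * (1 - fps_X ^ n) = 1 * (1 - fps_X ^ n)" .
  moreover have "(1 - fps_X ^ n :: complex fps) \<noteq> 0"
    using arg_cong[of "1 - fps_X ^ n :: complex fps" 0 "\<lambda>f. f $ 0"] assms by auto
  ultimately have FB: "fps_of_poly ?F * B = 1"
    by (metis mult_right_cancel)
  have coeff: "coeff (complex_cyclotomic (n * s)) k =
      (\<Sum>i\<le>k div s. coeff ?F i * b (int k - int i * int s))"
    if s: "prime s" "\<not> s dvd n" for s k
  proof -
    have s0: "s > 0"
      using s(1) by (rule prime_gt_0_nat)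
    define G where "G = fps_of_poly (pcompose ?F (monom 1 s))"
    have G: "G $ m = (if s dvd m then coeff ?F (m div s) else 0)" for m
      using s0 by (simp add: G_def fps_of_poly_pcompose fps_of_poly_monom fps_nth_compose_X_power)
    \<comment> \<open>As \<open>B\<close> inverts \<open>?F\<close>, multiplying by it divides the
      composed polynomial by \<open>?F\<close>.\<close>
    have "fps_of_poly (complex_cyclotomic (n * s)) =
        fps_of_poly (complex_cyclotomic (n * s)) * (fps_of_poly ?F * B)"
      by (simp add: FB)
    also have "\<dots> = G * B"
      unfolding G_def complex_cyclotomic_pcompose_monom[OF order.strict_trans[OF zero_less_one assms] s]
        fps_of_poly_mult by (simp only: ac_simps)
    finally have "coeff (complex_cyclotomic (n * s)) k = (G * B) $ k"
      by (metis fps_of_poly_nth)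
    also have "\<dots> = (\<Sum>m\<le>k. G $ m * b (int (k - m)))"
      by (simp add: fps_mult_nth B_def atLeast0AtMost)
    \<comment> \<open>\<open>G\<close> is supported on the multiples of \<open>s\<close>.\<close>
    also have "\<dots> = (\<Sum>m\<in>(\<lambda>i. i * s) ` {..k div s}. G $ m * b (int (k - m)))"
      using s0 by (intro sum.mono_neutral_right)
        (auto simp: G less_eq_div_iff_mult_less_eq image_iff elim!: dvdE, metis mult.commute)
    also have "\<dots> = (\<Sum>i\<le>k div s. coeff ?F i * b (int k - int i * int s))"
      using s0 by (subst sum.reindex)
        (auto simp: inj_on_def G less_eq_div_iff_mult_less_eq of_nat_diff intro!: sum.cong)
    finally show ?thesis .
  qed
  show ?thesis
    using anti cong coeff by (rule that)
qed

section \<open>From the coefficient formula to sets of coefficients\<close>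

text \<open>The \<open>s\<close> consecutive numbers with quotient \<open>q\<close> already cover
  every residue modulo \<open>n\<close>, since \<open>n \<le> s\<close>.\<close>

lemma exists_div_eq_cong:
  fixes n s q :: nat and j :: int
  assumes "0 < n" "n \<le> s"
  shows "\<exists>k. k div s = q \<and> [int k = j] (mod int n)"
proof (intro exI conjI)
  define r where "r = nat ((j - int q * int s) mod int n)"
  have r: "int r = (j - int q * int s) mod int n" "r < n"
    using assms by (auto simp: r_def nat_less_iff)
  show "(q * s + r) div s = q"
    using r(2) assms by simp
  show "[int (q * s + r) = j] (mod int n)"
    by (simp add: r(1) cong_def mod_add_right_eq)
qed

lemma cyclotomic_coeffs_complex:
  assumes "m > 0"
  shows "of_int ` cyclotomic_coeffs m = range (coeff (complex_cyclotomic m))"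
proof -
  have "complex_cyclotomic m = map_poly of_int (cyclotomic m)"
    using is_cyclotomic_cyclotomic[OF assms] by (simp add: is_cyclotomic_def)
  then show ?thesis
    by (auto simp: cyclotomic_coeffs_def coeff_set_def coeff_map_poly)
qed

theorem theorem6p3:
  fixes n s t :: nat
  assumes "n > 1"
    and "prime s" and "prime t"
    and "n < s" and "s < t"
    and "[int s = - int t] (mod int n)"
  shows "cyclotomic_coeffs (n * s) = uminus ` cyclotomic_coeffs (n * t)"
proof -
  obtain b :: "int \<Rightarrow> complex" and D where
    anti: "\<And>j. b (D - j) = - b j" and
    cong: "\<And>i j. [i = j] (mod int n) \<Longrightarrow> b i = b j" and
    coeff: "\<And>p k. prime p \<Longrightarrow> \<not> p dvd n \<Longrightarrow> coeff (complex_cyclotomic (n * p)) k =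
      (\<Sum>i\<le>k div p. coeff (complex_cyclotomic n) i * b (int k - int i * int p))"
    using coeff_complex_cyclotomic_prime_mult[OF assms(1)] by blast
  \<comment> \<open>In a coefficient, \<open>q\<close> and \<open>j\<close> both come from one
    \<open>k\<close>; \<open>S\<close> frees them from each other without enlarging the set of
    values.\<close>
  define S where "S p q j = (\<Sum>i\<le>q. coeff (complex_cyclotomic n) i * b (j - int i * int p))"
    for p q :: nat and j
  have S_cong: "S p q i = S p q j" if "[i = j] (mod int n)" for p q i j
    unfolding S_def using that by (intro sum.cong refl arg_cong2[of _ _ _ _ "(*)"] cong)
      (auto intro: cong_diff)
  have range: "of_int ` cyclotomic_coeffs (n * p) = range (\<lambda>(q, j). S p q j)"
    if p: "prime p" "n < p" for p
  proof -
    have ndvd: "\<not> p dvd n"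
      using p(2) assms(1) by (auto dest: dvd_imp_le)
    have "of_int ` cyclotomic_coeffs (n * p) = range (\<lambda>k. S p (k div p) (int k))"
      using p assms(1) cyclotomic_coeffs_complex[of "n * p"]
      by (simp add: S_def coeff[OF p(1) ndvd])
    also have "\<dots> = range (\<lambda>(q, j). S p q j)"
    proof (intro subset_antisym subsetI)
      fix x
      assume "x \<in> range (\<lambda>(q, j). S p q j)"
      then obtain q j where x: "x = S p q j" by auto
      obtain k where "k div p = q" "[int k = j] (mod int n)"
        using exists_div_eq_cong[of n p q j] assms(1) p(2) by auto
      then have "x = S p (k div p) (int k)"
        using S_cong x by metis
      then show "x \<in> range (\<lambda>k. S p (k div p) (int k))"
        by blast
    qed auto
    finally show ?thesis .
  qed
  \<comment> \<open>The congruence turns \<open>j - i s\<close> into \<open>j + i t\<close>, and the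
    antisymmetry of \<open>b\<close> sends this to \<open>(D - j) - i t\<close>. As \<open>j\<close>
    runs over all integers, so does \<open>D - j\<close>.\<close>
  have st: "S s q j = - S t q (D - j)" for q j
  proof -
    have "b (j - int i * int s) = - b (D - j - int i * int t)" for i
    proof -
      have "[j - int i * int s = j - int i * (- int t)] (mod int n)"
        using assms(6) by (intro cong_diff cong_mult cong_refl)
      then have "b (j - int i * int s) = b (j + int i * int t)"
        using cong by simp
      also have "\<dots> = - b (D - j - int i * int t)"
        using anti[of "j + int i * int t"] by (simp add: algebra_simps)
      finally show ?thesis .
    qed
    then show ?thesis
      by (simp add: S_def sum_negf)
  qed
  have "range (\<lambda>(q, j). S s q j) = uminus ` range (\<lambda>(q, j). S t q j)"
  proof (intro subset_antisym subsetI)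
    fix x
    assume "x \<in> uminus ` range (\<lambda>(q, j). S t q j)"
    then obtain q j where "x = - S t q j" by auto
    then have "x = S s q (D - j)"
      by (simp add: st)
    then show "x \<in> range (\<lambda>(q, j). S s q j)"
      by auto
  qed (auto simp: st)
  then have "(of_int :: int \<Rightarrow> complex) ` cyclotomic_coeffs (n * s) =
      uminus ` of_int ` cyclotomic_coeffs (n * t)"
    using range[of s] range[of t] assms by simp
  also have "\<dots> = of_int ` uminus ` cyclotomic_coeffs (n * t)"
    by (simp add: image_image)
  finally have "(of_int :: int \<Rightarrow> complex) ` cyclotomic_coeffs (n * s) =
      of_int ` uminus ` cyclotomic_coeffs (n * t)" .
  then show ?thesis
    by (simp add: inj_image_eq_iff inj_on_def)
qed

end
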